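(* Let $T\ge1$, let $f_1,\dots,f_T:\mathcal K\to\mathbb R$ be convex, let $x_1^*,\dots,x_T^*\in\mathcal K$, let $P\ge\sum_{t=1}^{T-1}\|x_{t+1}^*-x_t^*\|$, and let $\hat P\ge 0$. Let $x_1,\dots,x_T$ be the decisions of online projected subgradient descent on $\mathcal K$ with subgradients $g_t\in\partial f_t(x_t)$ and step sizes $$\eta_t=D\,G_t^{-1}\sqrt{\hat P/D+1/2}\qquad(\text{for } G_t>0),\qquad G_t=\sqrt{\sum_{\tau=1}^t\|g_\tau\|^2}.$$ Then $$\sum_{t=1}^T\bigl(f_t(x_t)-f_t(x_t^* )\bigr)\le D\,G_T\left(\frac{P/D+1/2}{\sqrt{\hat P/D+1/2}}+\sqrt{\hat P/D+1/2}\right).$$ If moreover $\hat P\ge P$, then $$\sum_{t=1}^T\bigl(f_t(x_t)-f_t(x_t^* )\bigr)\le 2D\,G_T\sqrt{\hat P/D+1/2}.$$ For fixed $P$ and $G_T$, the guarantee is minimized, as a function of $\hat P$, at $\hat P=P$.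
   Context: $\mathcal K\subset\mathbb R^N$ is a nonempty convex, closed and bounded set with diameter $D=\sup_{x,v\in\mathcal K}\|x-v\|>0$; $\|\cdot\|$ is the Euclidean norm and $\mathrm{Proj}_{\mathcal K}(x)=\arg\min_{v\in\mathcal K}\|x-v\|^2$. For convex $f:\mathcal K\to\mathbb R$, $\partial f(x)$ is the set of $g\in\mathbb R^N$ with $f(x)-f(v)\le g^\top(x-v)$ for all $v\in\mathcal K$. Online projected subgradient descent with step sizes $\eta_t$: start at an arbitrary $x_1\in\mathcal K$; at each round $t$, receive a subgradient $g_t\in\partial f_t(x_t)$; if $g_t=0$ set $x_{t+1}=x_t$, otherwise set $x_{t+1}=\mathrm{Proj}_{\mathcal K}(x_t-\eta_t g_t)$. No step size is needed in the initial rounds where $G_t=0$. *)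

theory Defs
  imports "HOL-Analysis.Analysis"
begin

text \<open>
  Sequences are indexed by \<^typ>\<open>nat\<close>, with rounds numbered from 1; the value at 0 is irrelevant.
  Subgradients are relative to \<open>K\<close>: the subgradient inequality is only required at points of \<open>K\<close>.
\<close>

definition subdifferential :: "'a::euclidean_space set \<Rightarrow> ('a \<Rightarrow> real) \<Rightarrow> 'a \<Rightarrow> 'a set" where
  "subdifferential K f x = {g. \<forall>v\<in>K. f x - f v \<le> g \<bullet> (x - v)}"

text \<open>
  The sequences \<open>f\<close>, \<open>\<eta>\<close>, \<open>g\<close> are arbitrary, so each may depend on the earlier rounds. For closed,
  convex, nonempty \<open>K\<close>, \<^const>\<open>closest_point\<close> is the Euclidean projection onto \<open>K\<close>. The value of
  \<open>\<eta> t\<close> is not used when \<open>g t = 0\<close>.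
\<close>

definition projected_subgradient_descent ::
  "'a::euclidean_space set \<Rightarrow> nat \<Rightarrow> (nat \<Rightarrow> 'a \<Rightarrow> real) \<Rightarrow> (nat \<Rightarrow> real) \<Rightarrow> (nat \<Rightarrow> 'a) \<Rightarrow> (nat \<Rightarrow> 'a) \<Rightarrow> bool"
where
  "projected_subgradient_descent K T f \<eta> g x \<longleftrightarrow>
     x 1 \<in> K \<and>
     (\<forall>t\<in>{1..T}. g t \<in> subdifferential K (f t) (x t)) \<and>
     (\<forall>t\<in>{1..<T}. x (t + 1) =
        (if g t = 0 then x t else closest_point K (x t - \<eta> t *\<^sub>R g t)))"

definition cumulative_norm :: "(nat \<Rightarrow> 'a::euclidean_space) \<Rightarrow> nat \<Rightarrow> real" where
  "cumulative_norm g t = sqrt (\<Sum>\<tau>=1..t. (norm (g \<tau>))\<^sup>2)"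

text \<open>Arguments: diameter, cumulative subgradient norm, path length bound, path length guess.\<close>

definition regret_guarantee :: "real \<Rightarrow> real \<Rightarrow> real \<Rightarrow> real \<Rightarrow> real" where
  "regret_guarantee D G P Q =
     D * G * ((P / D + 1 / 2) / sqrt (Q / D + 1 / 2) + sqrt (Q / D + 1 / 2))"

end

theory Submission
  imports Defs
begin

text \<open>
  Nonexpansiveness of the projection bounds the regret of round \<open>t\<close> against \<open>u = xstar t\<close>, after scaling
  by \<open>2 * \<eta> t\<close>, by \<open>(norm (x t - u))\<^sup>2 - (norm (x (t + 1) - u))\<^sup>2 + (\<eta> t)\<^sup>2 * (norm (g t))\<^sup>2\<close>. As \<open>1 / \<eta> t\<close>
  is proportional to the nondecreasing \<open>G\<^sub>t\<close>, the distance terms telescope up to the path length,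
  and the gradient terms telescope because \<open>(norm (g t))\<^sup>2 / G\<^sub>t \<le> 2 * (G\<^sub>t - G\<^sub>t\<^sub>-\<^sub>1)\<close>.
\<close>

text \<open>Since \<open>u\<close> lies in \<open>K\<close>, it is its own projection, so projecting
  the step brings it no farther from \<open>u\<close>; expanding the square of the unprojected
  distance gives the bound.\<close>

lemma projected_step_bound:
  fixes K :: "'a::euclidean_space set"
  assumes "convex K" "closed K" "u \<in> K"
  shows "2 * \<eta> * (g \<bullet> (x - u)) \<le>
    (norm (x - u))\<^sup>2 - (norm (closest_point K (x - \<eta> *\<^sub>R g) - u))\<^sup>2 + \<eta>\<^sup>2 * (norm g)\<^sup>2"
proof -
  have "dist (closest_point K (x - \<eta> *\<^sub>R g)) (closest_point K u) \<le> dist (x - \<eta> *\<^sub>R g) u"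
    using assms by (intro closest_point_lipschitz) auto
  then have "(norm (closest_point K (x - \<eta> *\<^sub>R g) - u))\<^sup>2 \<le> (norm ((x - u) - \<eta> *\<^sub>R g))\<^sup>2"
    using \<open>u \<in> K\<close> by (simp add: closest_point_self dist_norm algebra_simps power_mono)
  also have "\<dots> = (norm (x - u))\<^sup>2 - 2 * \<eta> * (g \<bullet> (x - u)) + \<eta>\<^sup>2 * (norm g)\<^sup>2"
    unfolding power2_norm_eq_inner
    by (simp add: inner_diff_left inner_diff_right inner_commute power2_eq_square algebra_simps)
  finally show ?thesis by simp
qed

lemma cumulative_norm_nonneg: "cumulative_norm g t \<ge> 0"
  by (simp add: cumulative_norm_def sum_nonneg)

lemma cumulative_norm_0 [simp]: "cumulative_norm g 0 = 0"
  by (simp add: cumulative_norm_def)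

lemma cumulative_norm_power2_Suc:
  "(cumulative_norm g (Suc t))\<^sup>2 = (cumulative_norm g t)\<^sup>2 + (norm (g (Suc t)))\<^sup>2"
  by (simp add: cumulative_norm_def sum_nonneg)

lemma cumulative_norm_le_Suc: "cumulative_norm g t \<le> cumulative_norm g (Suc t)"
  by (rule power2_le_imp_le) (simp_all add: cumulative_norm_power2_Suc cumulative_norm_nonneg)

lemma cumulative_norm_pos_Suc:
  assumes "g (Suc t) \<noteq> 0"
  shows "cumulative_norm g (Suc t) > 0"
proof -
  have "(cumulative_norm g (Suc t))\<^sup>2 > 0"
    using assms by (simp add: cumulative_norm_power2_Suc add_nonneg_pos)
  then show ?thesis
    using cumulative_norm_nonneg[of g "Suc t"] by (cases "cumulative_norm g (Suc t) = 0") auto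
qed

text \<open>With a and b the new and old cumulative norms, the left side is a^2 - b^2 = 2 a (a - b)
  - (a - b)^2. The division-free form also covers a = 0.\<close>

lemma norm_power2_le_cumulative_norm_diff:
  "(norm (g (Suc t)))\<^sup>2 \<le>
    2 * cumulative_norm g (Suc t) * (cumulative_norm g (Suc t) - cumulative_norm g t)"
proof -
  have "0 \<le> (cumulative_norm g (Suc t) - cumulative_norm g t)\<^sup>2" by simp
  then show ?thesis
    using cumulative_norm_power2_Suc[of g t] by (simp add: power2_eq_square algebra_simps)
qed

text \<open>This is the price of moving the comparator from \<open>u\<close> to \<open>v\<close>. In
  the factored difference of squares, the triangle inequality bounds the difference of the norms and
  \<open>2 * D\<close> bounds their sum.\<close>

lemma norm_diff_power2_le_shift:
  fixes y u v :: "'a::real_normed_vector"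
  assumes "norm (y - u) \<le> D" "norm (y - v) \<le> D"
  shows "(norm (y - v))\<^sup>2 \<le> (norm (y - u))\<^sup>2 + 2 * D * norm (v - u)"
proof -
  have "norm (y - v) - norm (y - u) \<le> norm (v - u)"
    using dist_triangle[of y v u] by (simp add: dist_norm norm_minus_commute)
  moreover have "0 \<le> D" using assms(1) norm_ge_zero order_trans by blast
  ultimately have "(norm (y - v) - norm (y - u)) * (norm (y - v) + norm (y - u)) \<le> norm (v - u) * (2 * D)"
    using assms by (intro order_trans[OF mult_right_mono[where b = "norm (v - u)"] mult_left_mono]) auto
  then show ?thesis by (simp add: power2_eq_square algebra_simps)
qed

lemma projected_subgradient_descent_in_set:
  assumes "projected_subgradient_descent K T f \<eta> g x" "closed K" "K \<noteq> {}" "t \<in> {1..T}"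
  shows "x t \<in> K"
proof -
  have "1 \<le> t" "t \<le> T" using assms(4) by auto
  then show ?thesis
  proof (induction t rule: nat_induct_at_least)
    case base
    then show ?case using assms(1) by (simp add: projected_subgradient_descent_def)
  next
    case (Suc n)
    then have "x (n + 1) = (if g n = 0 then x n else closest_point K (x n - \<eta> n *\<^sub>R g n))"
      using assms(1) unfolding projected_subgradient_descent_def by simp
    then show ?case using Suc assms(2,3) by (simp add: closest_point_in_set)
  qed
qed

text \<open>The weighted distance from \<open>y n\<close> to \<open>u n\<close> is kept on the left
  so that the next round can absorb it: this makes the bound an induction invariant. The sequence
  \<open>y\<close> names the point after each update, including round \<open>T\<close>, after which
  \<open>x\<close> is no longer constrained.\<close>

lemma adaptive_dynamic_linear_regret:
  fixes K :: "'a::euclidean_space set" and x u g y :: "nat \<Rightarrow> 'a"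
  assumes K: "convex K" "closed K" and D: "\<And>v w. v \<in> K \<Longrightarrow> w \<in> K \<Longrightarrow> norm (v - w) \<le> D"
    and c: "c > 0"
    and x: "\<And>t. t \<in> {1..T} \<Longrightarrow> x t \<in> K" and u: "\<And>t. t \<in> {1..T} \<Longrightarrow> u t \<in> K"
    and y: "\<And>t. t \<in> {1..T} \<Longrightarrow>
      y t = (if g t = 0 then x t else closest_point K (x t - (c / cumulative_norm g t) *\<^sub>R g t))"
    and x_Suc: "\<And>t. t \<in> {1..<T} \<Longrightarrow> x (Suc t) = y t"
    and "n \<le> T"
  shows "2 * c * (\<Sum>t=1..n. g t \<bullet> (x t - u t)) + cumulative_norm g n * (norm (y n - u n))\<^sup>2 \<le>
    cumulative_norm g n * (D\<^sup>2 + 2 * D * (\<Sum>t=1..<n. norm (u (Suc t) - u t)) + 2 * c\<^sup>2)"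
  using \<open>n \<le> T\<close>
proof (induction n)
  case 0
  then show ?case by simp
next
  case (Suc n)
  define G G' where "G = cumulative_norm g n" and "G' = cumulative_norm g (Suc n)"
  define S where "S k = (\<Sum>t=1..<k. norm (u (Suc t) - u t))" for k
  define a b' where "a = norm (x (Suc n) - u (Suc n))" and "b' = norm (y (Suc n) - u (Suc n))"
  have G: "0 \<le> G" "G \<le> G'"
    by (simp_all add: G_def G'_def cumulative_norm_nonneg cumulative_norm_le_Suc)
  have "x (Suc n) \<in> K" "u (Suc n) \<in> K" using Suc.prems x u by auto
  then have a: "0 \<le> a" "a \<le> D" using D by (auto simp: a_def)
  \<comment> \<open>The one-step bound is multiplied by \<open>G'\<close> to cancel the step size
    \<open>c / G'\<close>. In a round with zero subgradient the point does not move, so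
    \<open>a\<close> and \<open>b'\<close> agree.\<close>
  have round: "2 * c * (g (Suc n) \<bullet> (x (Suc n) - u (Suc n))) \<le> G' * (a\<^sup>2 - b'\<^sup>2) + 2 * c\<^sup>2 * (G' - G)"
  proof (cases "g (Suc n) = 0")
    case True
    then show ?thesis using Suc.prems y[of "Suc n"] G by (simp add: a_def b'_def)
  next
    case False
    then have "G' > 0" by (simp add: G'_def cumulative_norm_pos_Suc)
    have "2 * (c / G') * (g (Suc n) \<bullet> (x (Suc n) - u (Suc n))) \<le>
        a\<^sup>2 - b'\<^sup>2 + (c / G')\<^sup>2 * (norm (g (Suc n)))\<^sup>2"
      using projected_step_bound[OF K \<open>u (Suc n) \<in> K\<close>, of "c / G'" "g (Suc n)" "x (Suc n)"]
        False Suc.prems y[of "Suc n"] by (simp add: a_def b'_def G'_def)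
    also have "\<dots> \<le> a\<^sup>2 - b'\<^sup>2 + (c / G')\<^sup>2 * (2 * G' * (G' - G))"
      unfolding G_def G'_def by (intro add_left_mono mult_left_mono norm_power2_le_cumulative_norm_diff) simp
    finally have "G' * (2 * (c / G') * (g (Suc n) \<bullet> (x (Suc n) - u (Suc n)))) \<le>
        G' * (a\<^sup>2 - b'\<^sup>2 + (c / G')\<^sup>2 * (2 * G' * (G' - G)))"
      using \<open>G' > 0\<close> by (intro mult_left_mono) auto
    moreover have "G' * (2 * (c / G') * w) = 2 * c * w" for w
      using \<open>G' > 0\<close> by simp
    moreover have "G' * (a\<^sup>2 - b'\<^sup>2 + (c / G')\<^sup>2 * (2 * G' * (G' - G))) = G' * (a\<^sup>2 - b'\<^sup>2) + 2 * c\<^sup>2 * (G' - G)"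
      using \<open>G' > 0\<close> by (simp add: power2_eq_square field_simps)
    ultimately show ?thesis by simp
  qed
  \<comment> \<open>Replacing \<open>u n\<close> by \<open>u (Suc n)\<close> costs at most
    \<open>2 * D\<close> times the new path segment, which is exactly the growth of
    \<open>S\<close>. In the first round there is no previous comparator, but then \<open>G\<close>
    is zero.\<close>
  have "G * (D\<^sup>2 + 2 * D * S n - (norm (y n - u n))\<^sup>2) \<le> G * (D\<^sup>2 + 2 * D * S (Suc n) - a\<^sup>2)"
  proof (cases "n = 0")
    case True
    then show ?thesis by (simp add: G_def)
  next
    case False
    then have "x (Suc n) = y n" "u n \<in> K" using Suc.prems x_Suc u by auto
    then have "a\<^sup>2 \<le> (norm (y n - u n))\<^sup>2 + 2 * D * norm (u (Suc n) - u n)"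
      using \<open>x (Suc n) \<in> K\<close> \<open>u (Suc n) \<in> K\<close> D unfolding a_def
      by (metis norm_diff_power2_le_shift)
    then show ?thesis
      using False G by (intro mult_left_mono) (auto simp: S_def algebra_simps)
  qed
  \<comment> \<open>Raising the weight from \<open>G\<close> to \<open>G'\<close> requires a
    nonnegative bracket; the summand \<open>D\<^sup>2\<close> ensures this because
    \<open>a \<le> D\<close>.\<close>
  also have "\<dots> \<le> G' * (D\<^sup>2 + 2 * D * S (Suc n) - a\<^sup>2)"
  proof (intro mult_right_mono)
    have "0 \<le> S (Suc n)" by (simp add: S_def sum_nonneg)
    moreover have "a\<^sup>2 \<le> D\<^sup>2" using a by (simp add: power_mono)
    ultimately show "0 \<le> D\<^sup>2 + 2 * D * S (Suc n) - a\<^sup>2" using a by (simp add: add_increasing2)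
  qed (use G in simp)
  moreover have "2 * c * (\<Sum>t=1..n. g t \<bullet> (x t - u t)) + G * (norm (y n - u n))\<^sup>2
      \<le> G * (D\<^sup>2 + 2 * D * S n + 2 * c\<^sup>2)"
    using Suc by (simp add: G_def S_def)
  \<comment> \<open>On adding \<open>round\<close>, the terms \<open>G' * a\<^sup>2\<close> cancel
    and \<open>2 * c\<^sup>2 * (G' - G)\<close> turns the weight of \<open>2 * c\<^sup>2\<close>
    from \<open>G\<close> into \<open>G'\<close>.\<close>
  ultimately have "2 * c * (\<Sum>t=1..Suc n. g t \<bullet> (x t - u t)) + G' * b'\<^sup>2
      \<le> G' * (D\<^sup>2 + 2 * D * S (Suc n) + 2 * c\<^sup>2)"
    using round by (simp add: algebra_simps)
  then show ?case by (simp add: G'_def S_def b'_def)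
qed

text \<open>The invariant is applied at the last round with \<open>c = D * s\<close>, where
  \<open>s\<close> is the square root in the step size; dropping the final distance term and
  dividing by \<open>2 * D * s\<close> leaves the guarantee.\<close>

lemma dynamic_regret_bound:
  fixes K :: "'a::euclidean_space set"
  assumes K: "K \<noteq> {}" "convex K" "closed K" "bounded K" and "D = diameter K" "D > 0"
    and u: "\<And>t. t \<in> {1..T} \<Longrightarrow> u t \<in> K"
    and P: "P \<ge> (\<Sum>t=1..<T. norm (u (t + 1) - u t))"
    and "Q \<ge> 0"
    and psd: "projected_subgradient_descent K T f \<eta> g x"
    and \<eta>: "\<And>t. t \<in> {1..T} \<Longrightarrow> cumulative_norm g t > 0 \<Longrightarrow>
      \<eta> t = D * inverse (cumulative_norm g t) * sqrt (Q / D + 1 / 2)"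
  shows "(\<Sum>t=1..T. f t (x t) - f t (u t)) \<le> regret_guarantee D (cumulative_norm g T) P Q"
proof -
  define s where "s = sqrt (Q / D + 1 / 2)"
  define G where "G = cumulative_norm g T"
  define S where "S = (\<Sum>t=1..<T. norm (u (Suc t) - u t))"
  define y where "y t = (if g t = 0 then x t else closest_point K (x t - \<eta> t *\<^sub>R g t))" for t
  have "s > 0" using assms(6,9) by (simp add: s_def add_nonneg_pos)
  have "G \<ge> 0" by (simp add: G_def cumulative_norm_nonneg)
  have x: "x t \<in> K" if "t \<in> {1..T}" for t
    using projected_subgradient_descent_in_set[OF psd K(3,1) that] .
  have "2 * (D * s) * (\<Sum>t=1..T. g t \<bullet> (x t - u t)) + G * (norm (y T - u T))\<^sup>2 \<le>
      G * (D\<^sup>2 + 2 * D * S + 2 * (D * s)\<^sup>2)"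
    unfolding G_def S_def
  proof (rule adaptive_dynamic_linear_regret[where T = T, OF K(2,3)])
    show "norm (v - w) \<le> D" if "v \<in> K" "w \<in> K" for v w
      using diameter_bounded_bound[OF K(4) that] \<open>D = diameter K\<close> by (simp add: dist_norm)
    show "y t = (if g t = 0 then x t
        else closest_point K (x t - (D * s / cumulative_norm g t) *\<^sub>R g t))" if "t \<in> {1..T}" for t
    proof (cases "g t = 0")
      case False
      then have "cumulative_norm g t > 0"
        using that cumulative_norm_pos_Suc[of g "t - 1"] by auto
      then have "\<eta> t = D * s / cumulative_norm g t"
        unfolding s_def by (simp only: \<eta>[OF that] divide_inverse mult_ac)
      then show ?thesis by (simp add: y_def)
    qed (simp add: y_def)
    show "x (Suc t) = y t" if "t \<in> {1..<T}" for t
      using psd that by (simp add: projected_subgradient_descent_def y_def)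
  qed (use \<open>D > 0\<close> \<open>s > 0\<close> x u in auto)
  moreover have "0 \<le> G * (norm (y T - u T))\<^sup>2" using \<open>G \<ge> 0\<close> by simp
  moreover have "G * (D\<^sup>2 + 2 * D * S + 2 * (D * s)\<^sup>2) \<le> G * (D\<^sup>2 + 2 * D * P + 2 * (D * s)\<^sup>2)"
    using P \<open>G \<ge> 0\<close> \<open>D > 0\<close> by (intro mult_left_mono) (simp_all add: S_def)
  \<comment> \<open>The offset 1/2 arises here:
    \<open>D\<^sup>2 + 2 * D * P = 2 * D\<^sup>2 * (P / D + 1 / 2)\<close>.\<close>
  moreover have "G * (D\<^sup>2 + 2 * D * P + 2 * (D * s)\<^sup>2) = 2 * (D * s) * regret_guarantee D G P Q"
    using \<open>D > 0\<close> \<open>s > 0\<close> unfolding regret_guarantee_def s_def[symmetric]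
    by (simp add: power2_eq_square field_simps)
  ultimately have "2 * (D * s) * (\<Sum>t=1..T. g t \<bullet> (x t - u t)) \<le> 2 * (D * s) * regret_guarantee D G P Q"
    by linarith
  then have "(\<Sum>t=1..T. g t \<bullet> (x t - u t)) \<le> regret_guarantee D G P Q"
    using \<open>D > 0\<close> \<open>s > 0\<close> by simp
  moreover have "(\<Sum>t=1..T. f t (x t) - f t (u t)) \<le> (\<Sum>t=1..T. g t \<bullet> (x t - u t))"
    using psd u by (intro sum_mono) (auto simp: projected_subgradient_descent_def subdifferential_def)
  ultimately show ?thesis by (simp add: G_def)
qed

text \<open>The AM-GM inequality for \<open>p / s\<close> and \<open>s\<close>, whose product is
  \<open>p\<close>.\<close>

lemma two_sqrt_le_div_add:
  fixes p s :: real
  assumes "p \<ge> 0" "s > 0"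
  shows "2 * sqrt p \<le> p / s + s"
proof -
  have "0 \<le> (sqrt p - s)\<^sup>2" by simp
  then have "2 * sqrt p * s \<le> p + s * s"
    using assms by (simp add: power2_eq_square algebra_simps)
  then show ?thesis using assms by (simp add: field_simps)
qed

lemma regret_guarantee_self:
  assumes "D > 0" "P \<ge> 0"
  shows "regret_guarantee D G P P = 2 * D * G * sqrt (P / D + 1 / 2)"
proof -
  have "0 \<le> P / D + 1 / 2" using assms by simp
  then show ?thesis unfolding regret_guarantee_def real_div_sqrt[OF \<open>0 \<le> P / D + 1 / 2\<close>] by simp
qed

lemma regret_guarantee_mono:
  assumes "D > 0" "G \<ge> 0" "P \<le> P'" "Q \<ge> 0"
  shows "regret_guarantee D G P Q \<le> regret_guarantee D G P' Q"
  unfolding regret_guarantee_def using assms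
  by (intro mult_left_mono add_right_mono divide_right_mono) (auto simp: divide_right_mono)

text \<open>AM-GM bounds the guarantee below by a quantity independent of \<open>Q\<close>, and by
  \<open>regret_guarantee_self\<close> the choice \<open>Q = P\<close> attains it.\<close>

lemma is_arg_min_regret_guarantee:
  assumes "D > 0" "G \<ge> 0" "P \<ge> 0"
  shows "is_arg_min (regret_guarantee D G P) (\<lambda>Q. Q \<ge> 0) P"
proof -
  have "regret_guarantee D G P P \<le> regret_guarantee D G P Q" if "Q \<ge> 0" for Q
  proof -
    have "2 * sqrt (P / D + 1 / 2) \<le> (P / D + 1 / 2) / sqrt (Q / D + 1 / 2) + sqrt (Q / D + 1 / 2)"
      using assms that by (intro two_sqrt_le_div_add) (auto simp: add_nonneg_pos)
    then have "D * G * (2 * sqrt (P / D + 1 / 2)) \<le> regret_guarantee D G P Q"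
      unfolding regret_guarantee_def using assms by (intro mult_left_mono) auto
    then show ?thesis using assms by (simp add: regret_guarantee_self mult_ac)
  qed
  then show ?thesis using assms by (auto simp: is_arg_min_def not_less)
qed

theorem corollary2:
  fixes K :: "'a::euclidean_space set"
    and D P Phat :: real
    and T :: nat
    and f :: "nat \<Rightarrow> 'a \<Rightarrow> real"
    and x xstar g :: "nat \<Rightarrow> 'a"
    and \<eta> :: "nat \<Rightarrow> real"
  assumes "K \<noteq> {}" and "convex K" and "closed K" and "bounded K"
    and "D = diameter K" and "D > 0"
    and "T \<ge> 1"
    and "\<And>t. t \<in> {1..T} \<Longrightarrow> convex_on K (f t)"
    and "\<And>t. t \<in> {1..T} \<Longrightarrow> xstar t \<in> K"
    and "P \<ge> (\<Sum>t=1..<T. norm (xstar (t + 1) - xstar t))"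
    and "Phat \<ge> 0"
    and "projected_subgradient_descent K T f \<eta> g x"
    and "\<And>t. t \<in> {1..T} \<Longrightarrow> cumulative_norm g t > 0 \<Longrightarrow>
           \<eta> t = D * inverse (cumulative_norm g t) * sqrt (Phat / D + 1 / 2)"
  shows "(\<Sum>t=1..T. f t (x t) - f t (xstar t)) \<le> regret_guarantee D (cumulative_norm g T) P Phat \<and>
    (Phat \<ge> P \<longrightarrow>
      (\<Sum>t=1..T. f t (x t) - f t (xstar t)) \<le> 2 * D * cumulative_norm g T * sqrt (Phat / D + 1 / 2)) \<and>
    (\<forall>G\<ge>0. is_arg_min (regret_guarantee D G P) (\<lambda>Q. Q \<ge> 0) P)"
proof -
  have "0 \<le> (\<Sum>t=1..<T. norm (xstar (t + 1) - xstar t))" by (simp add: sum_nonneg)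
  then have "P \<ge> 0" using assms(10) by linarith
  have regret: "(\<Sum>t=1..T. f t (x t) - f t (xstar t)) \<le> regret_guarantee D (cumulative_norm g T) P Phat"
    using assms by (intro dynamic_regret_bound[where \<eta> = \<eta>]) auto
  \<comment> \<open>The path length bound is first enlarged from \<open>P\<close> to
    \<open>Phat\<close>; bound and guess then coincide and the two summands become equal.\<close>
  have "regret_guarantee D (cumulative_norm g T) P Phat \<le>
      2 * D * cumulative_norm g T * sqrt (Phat / D + 1 / 2)" if "Phat \<ge> P"
    using regret_guarantee_mono[OF \<open>D > 0\<close> cumulative_norm_nonneg that \<open>Phat \<ge> 0\<close>]
      regret_guarantee_self[OF \<open>D > 0\<close> \<open>Phat \<ge> 0\<close>] by metis
  then show ?thesis
    using regret is_arg_min_regret_guarantee[OF \<open>D > 0\<close> _ \<open>P \<ge> 0\<close>] by (blast intro: order_trans)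
qed

end
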